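(* For every $r=4t\ge48$ there exists a binary linear $[n,n-r,3]_2 4,2$ code with $n=2944\cdot2^{t-10}-3$. Consequently $\ell_2(4t,4)\le 2944\cdot 2^{t-10}-3$ for all $t\ge12$.
   Context: An $[n,n-r,d]_2R,\ell$ code is a binary linear code of length $n$, codimension $r$, minimum distance $d$, covering radius $R$ (smallest $R$ such that every vector of $\mathbb{F}_2^r$ is a sum of at most $R$ columns of a parity-check matrix $H$), such that some parity-check matrix $H$ admits an $(R,\ell)$-partition: a partition of its columns into nonempty subsets such that every vector of $\mathbb{F}_2^r$ (including zero) is the sum of at least $\ell$ and at most $R$ columns lying in pairwise distinct subsets. $\ell_2(r,R)$ is the smallest length of a binary linear code of codimension $r$ and covering radius $R$. *)

theory Defs
  imports Main
begin

text \<open>Vectors of F_2^r are represented as functions nat => bool supported on {..<r}.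
A binary r x n parity-check matrix H is given column-wise: H j is column j (j < n),
and H j i is its entry in row i (i < r).\<close>

definition F2vec :: "nat \<Rightarrow> (nat \<Rightarrow> bool) set" where
  "F2vec r = {v. \<forall>i\<ge>r. \<not> v i}"

definition zerovec :: "nat \<Rightarrow> bool" where
  "zerovec = (\<lambda>_. False)"

definition colsum :: "(nat \<Rightarrow> nat \<Rightarrow> bool) \<Rightarrow> nat set \<Rightarrow> (nat \<Rightarrow> bool)" where
  "colsum H S = (\<lambda>i. odd (card {j \<in> S. H j i}))"

definition is_pcm :: "nat \<Rightarrow> nat \<Rightarrow> (nat \<Rightarrow> nat \<Rightarrow> bool) \<Rightarrow> bool" where
  "is_pcm r n H = (\<forall>j<n. H j \<in> F2vec r)"

definition covers :: "nat \<Rightarrow> nat \<Rightarrow> (nat \<Rightarrow> nat \<Rightarrow> bool) \<Rightarrow> nat \<Rightarrow> bool" where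
  "covers r n H R = (\<forall>v\<in>F2vec r. \<exists>S\<subseteq>{..<n}. card S \<le> R \<and> colsum H S = v)"

definition has_covering_radius :: "nat \<Rightarrow> nat \<Rightarrow> (nat \<Rightarrow> nat \<Rightarrow> bool) \<Rightarrow> nat \<Rightarrow> bool" where
  "has_covering_radius r n H R = (covers r n H R \<and> (\<forall>R'<R. \<not> covers r n H R'))"

text \<open>Minimum distance = minimum weight of a nonzero codeword = minimum size of a
nonempty set of columns summing to zero.\<close>
definition has_min_distance :: "nat \<Rightarrow> (nat \<Rightarrow> nat \<Rightarrow> bool) \<Rightarrow> nat \<Rightarrow> bool" where
  "has_min_distance n H d =
     ((\<exists>S\<subseteq>{..<n}. S \<noteq> {} \<and> card S = d \<and> colsum H S = zerovec) \<and>
      (\<forall>S\<subseteq>{..<n}. S \<noteq> {} \<and> colsum H S = zerovec \<longrightarrow> d \<le> card S))"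

text \<open>(R,l)-partition of the columns: the partition is given by a labelling p of the
column indices (parts = nonempty fibres of p on {..<n}); "columns in pairwise distinct
subsets" means p is injective on the chosen index set.\<close>
definition has_RL_partition :: "nat \<Rightarrow> nat \<Rightarrow> (nat \<Rightarrow> nat \<Rightarrow> bool) \<Rightarrow> nat \<Rightarrow> nat \<Rightarrow> bool" where
  "has_RL_partition r n H R l =
     (\<exists>p :: nat \<Rightarrow> nat. \<forall>v\<in>F2vec r. \<exists>S\<subseteq>{..<n}.
        l \<le> card S \<and> card S \<le> R \<and> inj_on p S \<and> colsum H S = v)"

definition is_code_RL :: "nat \<Rightarrow> nat \<Rightarrow> nat \<Rightarrow> nat \<Rightarrow> nat \<Rightarrow> (nat \<Rightarrow> nat \<Rightarrow> bool) \<Rightarrow> bool" where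
  "is_code_RL n r d R l H =
     (is_pcm r n H \<and> has_min_distance n H d \<and> has_covering_radius r n H R \<and>
      has_RL_partition r n H R l)"

definition ell2 :: "nat \<Rightarrow> nat \<Rightarrow> nat" where
  "ell2 r R = (LEAST n. \<exists>H. is_pcm r n H \<and> has_covering_radius r n H R)"

end

theory Submission
  imports Defs
    "HOL-Algebra.Algebraic_Closure_Type"
    "HOL-Library.Z2"
    "HOL-Library.Function_Algebras"
    "HOL-Library.Product_Plus"
begin

text \<open>The code arises from the perfect repetition code \<open>[9, 1]\<close> of covering radius 4 by two
  concatenations with Reed-Solomon codes.

  First, let \<open>F\<close> be the field with 8 elements. Every vector of \<open>F\<^sub>2\<^sup>8\<close> is the sum
  of at most 4 of the 9 columns \<open>e\<^sub>j\<close>, \<open>j \<in> F \<union> {\<infinity>}\<close>, of the repetition code. Take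
  the columns \<open>(e\<^sub>j, \<xi> P\<^sub>j)\<close>, where \<open>P\<^sub>j = (1, j, j\<^sup>2, j\<^sup>3)\<close>, with
  \<open>P\<^sub>\<infinity> = (0, 0, 0, 1)\<close>, runs through the twisted cubic in \<open>PG(3, 8)\<close>. If all 4 columns of the repetition code are needed, any vector of \<open>F\<^sup>4\<close> can
  be produced in the second component, since 4 points of the twisted cubic are independent. If
  only \<open>w < 4\<close> are needed, then \<open>4 - w\<close> further columns are available; besides pairs of
  columns with the same \<open>j\<close>, whose sum is \<open>(0, \<xi> P\<^sub>j)\<close>, the 18 columns \<open>(0, x)\<close> with
  \<open>x\<close> a nonzero multiple of the third or fourth unit vector, or a multiple of the second one by an
  element of a 4-set \<open>Q\<close> with \<open>Q \<union> (Q + Q) = F\<close>, are enough. This gives 90 columns in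
  \<open>F\<^sub>2\<^sup>2\<^sup>0\<close> such that every vector is the sum of 3 or 4 distinct ones.

  Next, let \<open>F\<close> be the field with \<open>2 ^ m\<close> elements, \<open>m = t - 5 \<ge> 7\<close>, and label the 90
  columns \<open>c\<close> by distinct elements \<open>j\<close> of \<open>F\<close>. The columns \<open>(c, \<xi> P\<^sub>j)\<close> together with
  \<open>(0, \<xi> P\<^sub>\<gamma>)\<close>, \<open>\<xi> \<noteq> 0\<close>, for one more label \<open>\<gamma>\<close> have covering radius at most 4 in
  \<open>F\<^sub>2\<^sup>4\<^sup>t\<close>, because 4 distinct labels are always available. There are \<open>91 * 2 ^ m - 1\<close> of them, so
  that they can be extended arbitrarily to \<open>92 * 2 ^ m - 3 = 2944 * 2 ^ (t - 10) - 3\<close> distinct nonzero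
  columns. Since the columns contain a triple with sum 0, the partition into singletons is a
  \<open>(4, 2)\<close>-partition; that 3 columns do not suffice follows by counting.\<close>

section \<open>Elementary abelian 2-groups\<close>

class elementary_2_group = ab_group_add +
  assumes add_self [simp]: "x + x = 0"
begin

lemma add_self_left [simp]: "x + (x + y) = y"
  by (simp flip: add.assoc)

lemma uminus_eq_self: "- x = x"
  by (rule minus_unique) simp

lemma diff_eq_add: "x - y = x + y"
  using diff_conv_add_uminus uminus_eq_self by metis

lemma add_eq_0_iff_eq: "x + y = 0 \<longleftrightarrow> x = y"
  by (metis add_self add_self_left add_0_right)

text \<open>The summands over \<open>A \<inter> B\<close> occur twice and cancel.\<close>

lemma sum_sym_diff:
  assumes "finite A" "finite B"
  shows "sum f (sym_diff A B) = sum f A + sum f B"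
proof -
  have "sum f A = sum f (A - B) + sum f (A \<inter> B)"
    using assms by (metis Int_commute add.commute sum.Int_Diff)
  moreover have "sum f B = sum f (B - A) + sum f (A \<inter> B)"
    using assms by (metis Int_commute add.commute sum.Int_Diff)
  moreover have "sum f (sym_diff A B) = sum f (A - B) + sum f (B - A)"
    using assms by (intro sum.union_disjoint) auto
  ultimately show ?thesis
    by (simp add: algebra_simps)
qed

end

instance "fun" :: (type, elementary_2_group) elementary_2_group
  by standard (simp add: fun_eq_iff)

instance prod :: (elementary_2_group, elementary_2_group) elementary_2_group
  by standard (simp add: prod_eq_iff)

text \<open>Meant for groups of exponent 2, where every element is its own negative.\<close>

definition is_subgroup :: "'g::ab_group_add set \<Rightarrow> bool" where
  "is_subgroup V \<longleftrightarrow> 0 \<in> V \<and> (\<forall>x\<in>V. \<forall>y\<in>V. x + y \<in> V)"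

lemma is_subgroup_sum:
  assumes "is_subgroup V" "\<And>i. i \<in> T \<Longrightarrow> f i \<in> V"
  shows "sum f T \<in> V"
  using assms(2) by (induction T rule: infinite_finite_induct)
    (use assms(1) in \<open>auto simp: is_subgroup_def\<close>)

lemma is_subgroup_Times:
  "is_subgroup A \<Longrightarrow> is_subgroup B \<Longrightarrow> is_subgroup (A \<times> B)"
  by (auto simp: is_subgroup_def zero_prod_def)

text \<open>A basis over the field with two elements is chosen greedily: \<open>k < r\<close>
  independent elements have only \<open>2 ^ k\<close> subset sums, so \<open>V\<close> contains an
  element outside them.\<close>

lemma subgroup_basis:
  fixes V :: "'g::elementary_2_group set"
  assumes V: "is_subgroup V" "finite V" "card V = 2 ^ r"
  shows "\<exists>b. bij_betw (sum b) (Pow {..<r}) V"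
proof -
  have "\<exists>b. (\<forall>i<k. b i \<in> V) \<and> inj_on (sum b) (Pow {..<k})" if "k \<le> r" for k
    using that
  proof (induction k)
    case 0
    then show ?case by simp
  next
    case (Suc k)
    then obtain b where b: "\<forall>i<k. b i \<in> V" "inj_on (sum b) (Pow {..<k})"
      by auto
    let ?U = "sum b ` Pow {..<k}"
    have "card ?U = 2 ^ k"
      using b(2) by (simp add: card_image card_Pow)
    also have "\<dots> < card V"
      using V(3) Suc.prems by simp
    finally obtain v where v: "v \<in> V" "v \<notin> ?U"
      by (metis card_mono finite_imageI finite_Pow_iff finite_lessThan linorder_not_less subsetI)
    let ?b = "b(k := v)"
    have split: "sum ?b T = sum b (T - {k}) + (if k \<in> T then v else 0)"
      if "T \<in> Pow {..<Suc k}" for T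
    proof -
      have "finite T"
        using that finite_subset by auto
      moreover have "sum ?b (T - {k}) = sum b (T - {k})"
        by (intro sum.cong) auto
      ultimately show ?thesis
        by (cases "k \<in> T") (simp_all add: sum.remove[of T k] add.commute)
    qed
    \<comment> \<open>Such a coincidence would make \<open>v\<close> the subset sum over a symmetric
      difference.\<close>
    have no: False if "S \<in> Pow {..<k}" "T \<in> Pow {..<k}" "sum b S = sum b T + v" for S T
    proof -
      have "v = sum b T + sum b S"
        using that(3) by simp
      also have "\<dots> = sum b (sym_diff T S)"
        using that finite_subset by (intro sum_sym_diff[symmetric]) auto
      finally show False
        using v(2) that by auto
    qed
    have "inj_on (sum ?b) (Pow {..<Suc k})"
    proof (rule inj_onI)
      fix S T assume S: "S \<in> Pow {..<Suc k}" and T: "T \<in> Pow {..<Suc k}"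
        and eq: "sum ?b S = sum ?b T"
      have S': "S - {k} \<in> Pow {..<k}" and T': "T - {k} \<in> Pow {..<k}"
        using S T by auto
      have kk: "k \<in> S \<longleftrightarrow> k \<in> T"
        using eq no[OF S' T'] no[OF T' S'] unfolding split[OF S] split[OF T]
        by (auto split: if_splits)
      then have "sum b (S - {k}) = sum b (T - {k})"
        using eq unfolding split[OF S] split[OF T] by simp
      then have "S - {k} = T - {k}"
        using b(2) S' T' by (simp add: inj_on_eq_iff)
      then show "S = T"
        using kk by auto
    qed
    moreover have "\<forall>i<Suc k. ?b i \<in> V"
      using b(1) v(1) by (simp add: less_Suc_eq)
    ultimately show ?case
      by blast
  qed
  then obtain b where b: "\<forall>i<r. b i \<in> V" "inj_on (sum b) (Pow {..<r})"
    by auto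
  have "sum b ` Pow {..<r} = V"
  proof (rule card_subset_eq)
    show "sum b ` Pow {..<r} \<subseteq> V"
      using b(1) V(1) by (auto intro!: is_subgroup_sum)
  qed (use V b in \<open>auto simp: card_image card_Pow\<close>)
  then show ?thesis
    using b(2) by (auto simp: bij_betw_def)
qed

section \<open>Covering by sums of few elements\<close>

definition sums_le :: "'g::ab_group_add set \<Rightarrow> nat \<Rightarrow> 'g set" where
  "sums_le C k = {\<Sum>S | S. S \<subseteq> C \<and> finite S \<and> card S \<le> k}"

lemma sums_leI: "S \<subseteq> C \<Longrightarrow> finite S \<Longrightarrow> card S \<le> k \<Longrightarrow> \<Sum>S \<in> sums_le C k"
  by (auto simp: sums_le_def)

lemma sums_leE:
  assumes "v \<in> sums_le C k"
  obtains S where "S \<subseteq> C" "finite S" "card S \<le> k" "v = \<Sum>S"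
  using assms by (auto simp: sums_le_def)

lemma zero_sums_le [simp]: "0 \<in> sums_le C k"
  using sums_leI[of "{}" C k] by simp

lemma sums_le_member: "c \<in> C \<Longrightarrow> 0 < k \<Longrightarrow> c \<in> sums_le C k"
  using sums_leI[of "{c}" C k] by simp

lemma sums_le_mono: "C \<subseteq> D \<Longrightarrow> j \<le> k \<Longrightarrow> sums_le C j \<subseteq> sums_le D k"
  unfolding sums_le_def by force

lemma sums_le_add:
  fixes C :: "'g::elementary_2_group set"
  assumes "x \<in> sums_le C i" "y \<in> sums_le C j" "i + j \<le> k"
  shows "x + y \<in> sums_le C k"
proof -
  obtain A where A: "A \<subseteq> C" "finite A" "card A \<le> i" "x = \<Sum>A"
    using assms(1) by (rule sums_leE)
  obtain B where B: "B \<subseteq> C" "finite B" "card B \<le> j" "y = \<Sum>B"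
    using assms(2) by (rule sums_leE)
  have "card (sym_diff A B) \<le> card A + card B"
    using A(2) B(2) by (meson Diff_subset Un_mono card_Un_le card_mono finite_UnI order_trans)
  then have "\<Sum>(sym_diff A B) \<in> sums_le C k"
    using A B assms(3) by (intro sums_leI) auto
  then show ?thesis
    using A B by (simp add: sum_sym_diff)
qed

lemma sums_le_sum:
  fixes C :: "'g::elementary_2_group set"
  assumes "finite J" "\<And>j. j \<in> J \<Longrightarrow> f j \<in> sums_le C 1" "card J \<le> k"
  shows "sum f J \<in> sums_le C k"
proof -
  have "sum f J \<in> sums_le C (card J)"
    using assms(1,2)
  proof (induction J rule: finite_induct)
    case (insert j J)
    then show ?case
      using sums_le_add[of "f j" C 1 "sum f J" "card J"] by simp
  qed simp
  then show ?thesis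
    using sums_le_mono[OF order_refl assms(3)] by auto
qed

section \<open>From subsets of elementary abelian 2-groups to codes\<close>

lemma colsum_insert:
  assumes "finite S" "j \<notin> S"
  shows "colsum H (insert j S) = (\<lambda>i. H j i \<noteq> colsum H S i)"
proof
  fix i
  have "{k \<in> insert j S. H k i} = (if H j i then insert j {k \<in> S. H k i} else {k \<in> S. H k i})"
    by auto
  then show "colsum H (insert j S) i = (H j i \<noteq> colsum H S i)"
    using assms by (simp add: colsum_def)
qed

lemma F2vec_eq: "F2vec r = (\<lambda>T i. i \<in> T) ` Pow {..<r}"
proof (intro equalityI subsetI)
  fix f assume "f \<in> F2vec r"
  then show "f \<in> (\<lambda>T i. i \<in> T) ` Pow {..<r}"
    by (intro image_eqI[of _ _ "{i. f i}"]) (auto simp: F2vec_def intro: leI)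
qed (auto simp: F2vec_def)

lemma card_F2vec: "card (F2vec r) = 2 ^ r"
proof -
  have "inj_on (\<lambda>T (i::nat). i \<in> T) (Pow {..<r})"
    by (auto simp: inj_on_def fun_eq_iff)
  then show ?thesis
    by (simp add: F2vec_eq card_image card_Pow)
qed

text \<open>Sets of at most three columns are encoded by triples from \<open>{..n}\<close>, so they
  have at most \<open>(n + 1) ^ 3\<close> sums.\<close>

lemma not_covers_3:
  assumes "(n + 1) ^ 3 < 2 ^ r"
  shows "\<not> covers r n H 3"
proof
  assume cov: "covers r n H 3"
  let ?P = "{..n} \<times> {..n} \<times> {..n}"
  let ?f = "\<lambda>(a, b, c). colsum H ({a, b, c} \<inter> {..<n})"
  have "F2vec r \<subseteq> ?f ` ?P"
  proof
    fix v assume "v \<in> F2vec r"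
    then obtain S where S: "S \<subseteq> {..<n}" "card S \<le> 3" "colsum H S = v"
      using cov unfolding covers_def by blast
    have "finite S"
      using S(1) finite_subset by blast
    then obtain xs where xs: "set xs = S" "length xs = card S"
      using finite_distinct_list distinct_card by metis
    \<comment> \<open>The index \<open>n\<close> stands for no column; intersecting with
      \<open>{..<n}\<close> removes it.\<close>
    define ys where "ys = xs @ replicate (3 - card S) n"
    have "length ys = 3"
      using xs S(2) by (simp add: ys_def)
    then obtain a b c where abc: "ys = [a, b, c]"
      by (auto simp: length_Suc_conv numeral_3_eq_3)
    have "S \<subseteq> set ys" "set ys \<subseteq> insert n S"
      using xs(1) by (auto simp: ys_def)
    then have "{a, b, c} \<subseteq> {..n}" "{a, b, c} \<inter> {..<n} = S"
      using S(1) by (auto simp: abc)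
    then have "(a, b, c) \<in> ?P" "?f (a, b, c) = v"
      using S(3) by auto
    then show "v \<in> ?f ` ?P"
      by (intro image_eqI[of _ ?f "(a, b, c)"]) simp_all
  qed
  then have "card (F2vec r) \<le> card ?P"
    by (intro surj_card_le) auto
  also have "card ?P = (n + 1) ^ 3"
    by (simp add: card_cartesian_product power3_eq_cube)
  finally show False
    using assms by (simp add: card_F2vec)
qed

text \<open>A basis of \<open>V\<close> turns the elements of \<open>C\<close> into columns.
  Distinct nonzero columns have distance at least 3, which the zero-sum triple attains.\<close>

lemma code_from_group:
  fixes V :: "'g::elementary_2_group set"
  assumes V: "is_subgroup V" "finite V" "card V = 2 ^ r"
    and C: "C \<subseteq> V" "0 \<notin> C" "card C = n"
    and cov: "V \<subseteq> sums_le C 4"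
    and triple: "a \<in> C" "b \<in> C" "a \<noteq> b" "a + b \<in> C"
    and small: "(n + 1) ^ 3 < 2 ^ r"
  shows "\<exists>H. is_code_RL n r 3 4 2 H"
proof -
  obtain e where e: "bij_betw (sum e) (Pow {..<r}) V"
    using subgroup_basis[OF V] by blast
  \<comment> \<open>\<open>\<psi>\<close> sends a bit vector to the group element with these
    coordinates.\<close>
  define \<psi> where "\<psi> f = sum e {i. f i}" for f
  have fin: "finite {i. f i}" if "f \<in> F2vec r" for f
    using that by (auto simp: F2vec_eq intro: finite_subset)
  have \<psi>_bij: "bij_betw \<psi> (F2vec r) V"
  proof -
    have "bij_betw Collect (F2vec r) (Pow {..<r})"
      unfolding F2vec_eq by (rule bij_betw_byWitness[where f' = "\<lambda>T i. i \<in> T"]) auto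
    from bij_betw_trans[OF this e] show ?thesis
      by (simp add: \<psi>_def[abs_def] comp_def)
  qed
  have \<psi>_add: "\<psi> (\<lambda>i. f i \<noteq> g i) = \<psi> f + \<psi> g" if "f \<in> F2vec r" "g \<in> F2vec r" for f g
  proof -
    have "{i. f i \<noteq> g i} = sym_diff {i. f i} {i. g i}"
      by auto
    then show ?thesis
      unfolding \<psi>_def using that fin by (simp add: sum_sym_diff)
  qed
  have "finite C"
    using C(1) V(2) finite_subset by blast
  then obtain c where c: "bij_betw c {..<n} C"
    using C(3) ex_bij_betw_nat_finite[of C] by (auto simp: atLeast0LessThan)
  define H where "H j = inv_into (F2vec r) \<psi> (c j)" for j
  have H: "H j \<in> F2vec r" "\<psi> (H j) = c j" if "j < n" for j
  proof -
    have "c j \<in> \<psi> ` F2vec r"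
      using c C(1) \<psi>_bij that by (auto simp: bij_betw_def)
    then show "H j \<in> F2vec r" "\<psi> (H j) = c j"
      unfolding H_def by (auto simp: inv_into_into f_inv_into_f)
  qed
  have cs: "colsum H S \<in> F2vec r \<and> \<psi> (colsum H S) = sum c S" if "S \<subseteq> {..<n}" for S
  proof -
    have "finite S"
      using that finite_subset by blast
    then show ?thesis
      using that
    proof (induction S rule: finite_induct)
      case empty
      then show ?case
        by (simp add: colsum_def F2vec_def \<psi>_def)
    next
      case (insert j S)
      then have "j < n" and IH: "colsum H S \<in> F2vec r" "\<psi> (colsum H S) = sum c S"
        by auto
      have "(\<lambda>i. H j i \<noteq> colsum H S i) \<in> F2vec r"
        using IH(1) H(1)[OF \<open>j < n\<close>] by (auto simp: F2vec_def)
      then show ?case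
        using insert.hyps \<psi>_add[OF H(1)[OF \<open>j < n\<close>] IH(1)] H(2)[OF \<open>j < n\<close>] IH(2)
        by (simp add: colsum_insert)
    qed
  qed
  have cs_eq: "colsum H S = v" if "S \<subseteq> {..<n}" "v \<in> F2vec r" "sum c S = \<psi> v" for S v
    using cs[OF that(1)] that \<psi>_bij by (metis bij_betw_imp_inj_on inj_onD)
  have zero: "zerovec \<in> F2vec r" "\<psi> zerovec = 0"
    by (auto simp: zerovec_def F2vec_def \<psi>_def)
  have pull: "\<exists>S'\<subseteq>{..<n}. card S' = card S \<and> colsum H S' = v"
    if S: "S \<subseteq> C" "\<Sum>S = \<psi> v" and v: "v \<in> F2vec r" for S v
  proof -
    define S' where "S' = inv_into {..<n} c ` S"
    have "S' \<subseteq> {..<n}"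
      using S(1) c by (auto simp: S'_def bij_betw_def inv_into_into)
    moreover have inj: "inj_on c S'"
      using \<open>S' \<subseteq> {..<n}\<close> c by (meson bij_betw_imp_inj_on inj_on_subset)
    moreover have "c ` S' = S"
      using S(1) c by (auto simp: S'_def bij_betw_def image_image f_inv_into_f subset_iff)
    ultimately have "card S' = card S" "sum c S' = \<Sum>S"
      using card_image[OF inj] sum.reindex[OF inj, of "\<lambda>x. x"] by simp_all
    then show ?thesis
      using cs_eq[OF \<open>S' \<subseteq> {..<n}\<close> v] S(2) \<open>S' \<subseteq> {..<n}\<close> by auto
  qed
  have ne: "a \<noteq> 0" "b \<noteq> 0" "a \<noteq> a + b" "b \<noteq> a + b"
    using triple C(2) by auto
  have card3: "card {a, b, a + b} = 3" "\<Sum>{a, b, a + b} = 0"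
    using ne triple(3) by (simp_all add: add.left_commute[of b a])
  \<comment> \<open>A member of the triple is the sum of the other two, 0 is the sum of all three,
    and any other column is lengthened by the triple. What is neither 0 nor a column needs at least
    two columns anyway.\<close>
  have part: "\<exists>S\<subseteq>C. 2 \<le> card S \<and> card S \<le> 4 \<and> \<Sum>S = x" if "x \<in> V" for x
  proof -
    consider "x \<in> {a, b, a + b}" | "x = 0" | "x \<in> C" "x \<notin> {a, b, a + b}" | "x \<notin> C" "x \<noteq> 0"
      by blast
    then show ?thesis
    proof cases
      case 1
      have "\<Sum>({a, b, a + b} - {x}) = x"
        using sum.remove[of "{a, b, a + b}" x "\<lambda>x. x"] 1 card3(2) add_eq_0_iff_eq
        by (metis finite.emptyI finite.insertI)
      moreover have "card ({a, b, a + b} - {x}) = 2"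
        using 1 card3(1) by (subst card_Diff_singleton) auto
      ultimately show ?thesis
        using triple by (intro exI[of _ "{a, b, a + b} - {x}"] conjI) auto
    next
      case 2
      then show ?thesis
        using triple card3 by (intro exI[of _ "{a, b, a + b}"]) auto
    next
      case 3
      have "card (insert x {a, b, a + b}) = 4"
        using card_insert_disjoint[OF _ 3(2)] card3(1) by simp
      moreover have "\<Sum>(insert x {a, b, a + b}) = x"
        using sum.insert[OF _ 3(2), of "\<lambda>x. x"] card3(2) by simp
      ultimately show ?thesis
        using 3 triple by (intro exI[of _ "insert x {a, b, a + b}"]) auto
    next
      case 4
      obtain S where S: "S \<subseteq> C" "finite S" "card S \<le> 4" "x = \<Sum>S"
        using cov \<open>x \<in> V\<close> by (auto elim: sums_leE)
      have "card S \<noteq> 0" "card S \<noteq> 1"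
        using 4 S by (auto simp: card_1_singleton_iff)
      then have "2 \<le> card S"
        by linarith
      then show ?thesis
        using S by blast
    qed
  qed
  have part': "\<exists>S\<subseteq>{..<n}. 2 \<le> card S \<and> card S \<le> 4 \<and> colsum H S = v" if v: "v \<in> F2vec r" for v
  proof -
    have "\<psi> v \<in> V"
      using \<psi>_bij v by (auto simp: bij_betw_def)
    then obtain S where S: "S \<subseteq> C" "2 \<le> card S" "card S \<le> 4" "\<Sum>S = \<psi> v"
      using part by blast
    then show ?thesis
      using pull[OF S(1,4) v] by metis
  qed
  have "has_min_distance n H 3"
    unfolding has_min_distance_def
  proof (intro conjI allI impI)
    obtain S where "S \<subseteq> {..<n}" "card S = 3" "colsum H S = zerovec"
      using pull[of "{a, b, a + b}" zerovec] card3 zero triple by auto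
    then show "\<exists>S\<subseteq>{..<n}. S \<noteq> {} \<and> card S = 3 \<and> colsum H S = zerovec"
      by (intro exI[of _ S]) auto
  next
    fix S assume "S \<subseteq> {..<n}" and S: "S \<noteq> {} \<and> colsum H S = zerovec"
    have "finite S"
      using \<open>S \<subseteq> {..<n}\<close> finite_subset by blast
    have "sum c S = 0"
      using cs[OF \<open>S \<subseteq> {..<n}\<close>] S zero(2) by simp
    have "card S \<noteq> 0"
      using S \<open>finite S\<close> by simp
    moreover have "card S \<noteq> 1"
    proof
      assume "card S = 1"
      then obtain j where "S = {j}"
        by (auto simp: card_1_singleton_iff)
      then have "c j = 0" "j < n"
        using \<open>sum c S = 0\<close> \<open>S \<subseteq> {..<n}\<close> by auto
      then show False
        using c C(2) by (auto simp: bij_betw_def)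
    qed
    moreover have "card S \<noteq> 2"
    proof
      assume "card S = 2"
      then obtain j k where jk: "S = {j, k}" "j \<noteq> k"
        by (auto simp: card_2_iff)
      then have "c j = c k" "j < n" "k < n"
        using \<open>sum c S = 0\<close> \<open>S \<subseteq> {..<n}\<close> by (auto simp: add_eq_0_iff_eq)
      then show False
        using c jk(2) by (auto simp: bij_betw_def inj_on_def)
    qed
    ultimately show "3 \<le> card S"
      by linarith
  qed
  moreover have "has_covering_radius r n H 4"
    unfolding has_covering_radius_def
  proof (intro conjI allI impI notI)
    show "covers r n H 4"
      unfolding covers_def using part' by blast
  next
    \<comment> \<open>Covering is monotone in the radius, so excluding radius 3 suffices.\<close>
    fix R assume "R < (4::nat)" and "covers r n H R"
    moreover from \<open>R < 4\<close> have "R \<le> 3"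
      by simp
    ultimately have "covers r n H 3"
      unfolding covers_def by (meson order_trans)
    then show False
      using not_covers_3[OF small] by blast
  qed
  moreover have "has_RL_partition r n H 4 2"
    unfolding has_RL_partition_def using part' by (intro exI[of _ id]) simp
  moreover have "is_pcm r n H"
    unfolding is_pcm_def using H by blast
  ultimately show ?thesis
    by (intro exI[of _ H]) (simp add: is_code_RL_def)
qed

section \<open>Concatenation with a Reed-Solomon code\<close>

lemma sum_fun_apply: "sum f A x = (\<Sum>a\<in>A. f a x)"
  for f :: "'a \<Rightarrow> 'b \<Rightarrow> 'c::comm_monoid_add"
  by (induction A rule: infinite_finite_induct) auto

text \<open>Powers of \<open>A\<close> live inside a function type and inherit its pointwise
  addition; the value 0 outside \<open>I\<close> makes restriction to \<open>I\<close>
  injective.\<close>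

definition supported :: "'i set \<Rightarrow> 'a::zero set \<Rightarrow> ('i \<Rightarrow> 'a) set" where
  "supported I A = {f. (\<forall>i\<in>I. f i \<in> A) \<and> (\<forall>i. i \<notin> I \<longrightarrow> f i = 0)}"

lemma bij_betw_supported: "bij_betw (\<lambda>f. restrict f I) (supported I A) (PiE I (\<lambda>_. A))"
  by (rule bij_betw_byWitness[where f' = "\<lambda>f i. if i \<in> I then f i else 0"])
    (auto simp: supported_def fun_eq_iff PiE_def extensional_def)

lemma card_supported: "finite I \<Longrightarrow> card (supported I A) = card A ^ card I"
  using bij_betw_same_card[OF bij_betw_supported[of I A]] by (simp add: card_PiE)

lemma finite_supported: "finite I \<Longrightarrow> finite A \<Longrightarrow> finite (supported I A)"
  using bij_betw_finite[OF bij_betw_supported[of I A]] by (simp add: finite_PiE)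

lemma is_subgroup_supported: "is_subgroup A \<Longrightarrow> is_subgroup (supported I A)"
  by (auto simp: is_subgroup_def supported_def)

text \<open>The multiple by \<open>\<xi>\<close> of the point with parameter \<open>\<beta>\<close>
  on the twisted cubic. As \<open>0 ^ 0 = 1\<close>, the parameter 0 gives the first unit
  vector.\<close>

definition pvec :: "'k::field \<Rightarrow> 'k \<Rightarrow> nat \<Rightarrow> 'k" where
  "pvec \<beta> \<xi> = (\<lambda>i. if i < 4 then \<xi> * \<beta> ^ i else 0)"

lemma pvec_0 [simp]: "pvec \<beta> 0 = 0"
  by (simp add: pvec_def fun_eq_iff)

lemma pvec_add: "pvec \<beta> (\<xi> + \<eta>) = pvec \<beta> \<xi> + pvec \<beta> \<eta>"
  by (auto simp: pvec_def fun_eq_iff algebra_simps)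

lemma pvec_eq_iff [simp]: "pvec \<beta> \<xi> = pvec \<beta> \<eta> \<longleftrightarrow> \<xi> = \<eta>"
proof
  assume "pvec \<beta> \<xi> = pvec \<beta> \<eta>"
  then have "pvec \<beta> \<xi> 0 = pvec \<beta> \<eta> 0"
    by simp
  then show "\<xi> = \<eta>"
    by (simp add: pvec_def)
qed simp

lemma pvec_eq_0_iff [simp]: "pvec \<beta> \<xi> = 0 \<longleftrightarrow> \<xi> = 0"
  using pvec_eq_iff[of \<beta> \<xi> 0] unfolding pvec_0 .

text \<open>Taking the field as a subset lets fields of different orders share one type.\<close>

locale finite_char2_subfield =
  fixes F :: "'k::{field, elementary_2_group} set"
  assumes finite: "finite F"
    and zero [simp, intro]: "0 \<in> F"
    and one [simp, intro]: "1 \<in> F"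
    and add [intro]: "x \<in> F \<Longrightarrow> y \<in> F \<Longrightarrow> x + y \<in> F"
    and mult [intro]: "x \<in> F \<Longrightarrow> y \<in> F \<Longrightarrow> x * y \<in> F"
    and inverse [intro]: "x \<in> F \<Longrightarrow> inverse x \<in> F"
begin

lemma divide [intro]: "x \<in> F \<Longrightarrow> y \<in> F \<Longrightarrow> x / y \<in> F"
  by (auto simp: divide_inverse)

lemma power [intro]: "x \<in> F \<Longrightarrow> x ^ n \<in> F"
  by (induction n) auto

lemma subgroup: "is_subgroup F"
  by (auto simp: is_subgroup_def)

lemma sum_closed: "(\<And>i. i \<in> T \<Longrightarrow> f i \<in> F) \<Longrightarrow> sum f T \<in> F"
  by (rule is_subgroup_sum[OF subgroup])

lemma pvec_supported: "\<beta> \<in> F \<Longrightarrow> \<xi> \<in> F \<Longrightarrow> pvec \<beta> \<xi> \<in> supported {..<4::nat} F"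
  by (auto simp: supported_def pvec_def)

lemma obtain_not_in:
  assumes "finite A" "card A < card F"
  obtains x where "x \<in> F" "x \<notin> A"
  using assms by (meson card_mono linorder_not_less subsetI)

text \<open>If the coefficients \<open>\<eta>\<close> solve the system on \<open>S\<close> with right-hand side
  \<open>x (i + 1) - a x i\<close>, then the coefficients \<open>\<eta> s / (s - a)\<close> together with a suitable
  coefficient of the new node \<open>a\<close> solve the system with right-hand side \<open>x\<close>.\<close>

lemma vandermonde_solvable:
  assumes "finite S" "S \<subseteq> F" "\<And>i. x i \<in> F"
  shows "\<exists>\<xi>. (\<forall>s. \<xi> s \<in> F) \<and> (\<forall>i<card S. (\<Sum>s\<in>S. \<xi> s * s ^ i) = x i)"
  using assms
proof (induction S arbitrary: x rule: finite_induct)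
  case empty
  then show ?case
    by (intro exI[of _ "\<lambda>_. 0"]) simp
next
  case (insert a S)
  have "a \<in> F"
    using insert.prems by simp
  then have "x (Suc i) - a * x i \<in> F" for i
    using insert.prems(2) by (auto simp: diff_eq_add)
  then obtain \<eta> where \<eta>: "\<And>s. \<eta> s \<in> F"
    "\<And>i. i < card S \<Longrightarrow> (\<Sum>s\<in>S. \<eta> s * s ^ i) = x (Suc i) - a * x i"
    using insert.IH[of "\<lambda>i. x (Suc i) - a * x i"] insert.prems(1) by blast
  \<comment> \<open>The coefficient of \<open>a\<close> is dictated by the equation for exponent
    0.\<close>
  define \<xi> where "\<xi> s =
    (if s = a then x 0 - (\<Sum>s\<in>S. \<eta> s / (s - a)) else if s \<in> S then \<eta> s / (s - a) else 0)" for s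
  have quot: "\<eta> s / (s - a) \<in> F" if "s \<in> S" for s
    using \<eta>(1) insert.prems(1) \<open>a \<in> F\<close> that unfolding diff_eq_add by blast
  have \<xi>S: "\<xi> s = \<eta> s / (s - a)" if "s \<in> S" for s
    using that insert.hyps(2) by (auto simp: \<xi>_def)
  have "\<xi> s \<in> F" for s
    using quot insert.prems(2) by (auto simp: \<xi>_def diff_eq_add intro!: add sum_closed)
  moreover have "(\<Sum>s\<in>insert a S. \<xi> s * s ^ i) = x i" if "i < card (insert a S)" for i
    using that
  proof (induction i)
    case 0
    then show ?case
      using insert.hyps \<xi>S by (simp add: \<xi>_def)
  next
    \<comment> \<open>The equation for \<open>Suc i\<close> follows from that for \<open>i\<close>
      by writing \<open>s ^ Suc i\<close> as \<open>(s - a) * s ^ i + a * s ^ i\<close>.\<close>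
    case (Suc i)
    then have "i < card S"
      using insert.hyps by simp
    have "\<xi> s * (s - a) = \<eta> s" if "s \<in> S" for s
      using that insert.hyps(2) by (auto simp: \<xi>S)
    then have "x (Suc i) - a * x i = (\<Sum>s\<in>S. \<xi> s * (s - a) * s ^ i)"
      using \<eta>(2)[OF \<open>i < card S\<close>] by simp
    also have "\<dots> = (\<Sum>s\<in>S. \<xi> s * s ^ Suc i) - a * (\<Sum>s\<in>S. \<xi> s * s ^ i)"
      by (simp add: algebra_simps sum_subtractf sum_distrib_left)
    finally have "(\<Sum>s\<in>S. \<xi> s * s ^ Suc i) = x (Suc i) - a * x i + a * (\<Sum>s\<in>S. \<xi> s * s ^ i)"
      by simp
    moreover have "(\<Sum>s\<in>S. \<xi> s * s ^ i) = x i - \<xi> a * a ^ i"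
      using Suc insert.hyps by (simp add: algebra_simps)
    ultimately show ?case
      using insert.hyps by (simp add: algebra_simps)
  qed
  ultimately show ?case
    by blast
qed

text \<open>With four distinct labels as nodes the Vandermonde system is solvable for every
  right-hand side. The one spare label \<open>\<gamma>\<close> is the fourth node when only three
  columns are used, which is why \<open>cov\<close> asks for at least three.\<close>

lemma concatenation:
  fixes V C :: "'g::elementary_2_group set"
  assumes C: "C \<subseteq> V" "finite C" "0 \<notin> C" "card C < card F"
    and V: "is_subgroup V"
    and F: "2 < card F"
    and cov: "\<And>v. v \<in> V \<Longrightarrow> \<exists>S\<subseteq>C. 3 \<le> card S \<and> card S \<le> 4 \<and> \<Sum>S = v"
  obtains D a b where "D \<subseteq> V \<times> supported {..<4::nat} F" "0 \<notin> D"
    "card D < (card C + 1) * card F" "V \<times> supported {..<4::nat} F \<subseteq> sums_le D 4"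
    "a \<in> D" "b \<in> D" "a \<noteq> b" "a + b \<in> D"
proof -
  obtain l where l: "l ` C \<subseteq> F" "inj_on l C"
    using card_le_inj[OF C(2) finite] C(4) by auto
  obtain \<gamma> where \<gamma>: "\<gamma> \<in> F" "\<gamma> \<notin> l ` C"
    using obtain_not_in[of "l ` C"] C(2,4) card_image_le[OF C(2), of l] by auto
  let ?V = "V \<times> supported {..<4::nat} F"
  define D1 where "D1 = (\<lambda>(c, \<xi>). (c, pvec (l c) \<xi>)) ` (C \<times> F)"
  define D2 where "D2 = (\<lambda>\<eta>. (0 :: 'g, pvec \<gamma> \<eta>)) ` (F - {0})"
  let ?D = "D1 \<union> D2"
  have "card ?D \<le> card (C \<times> F) + card (F - {0})"
    unfolding D1_def D2_def using C(2) finite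
    by (intro order_trans[OF card_Un_le] add_mono card_image_le) auto
  also have "\<dots> < (card C + 1) * card F"
    using F finite by (simp add: card_cartesian_product)
  finally have D_card: "card ?D < (card C + 1) * card F" .
  have D_sub: "?D \<subseteq> ?V"
    using C(1) V l(1) \<gamma>(1) pvec_supported by (auto simp: D1_def D2_def is_subgroup_def)
  have D_0: "0 \<notin> ?D"
    using C(3) by (auto simp: D1_def D2_def prod_eq_iff)
  have cov_D: "?V \<subseteq> sums_le ?D 4"
  proof safe
    fix v x assume v: "v \<in> V" and x: "x \<in> supported {..<4::nat} F"
    obtain S where S: "S \<subseteq> C" "3 \<le> card S" "card S \<le> 4" "\<Sum>S = v"
      using cov[OF v] by blast
    have "finite S"
      using S(1) C(2) finite_subset by blast
    have inj: "inj_on l S"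
      using l(2) S(1) inj_on_subset by blast
    define T where "T = (if card S = 4 then {} else {\<gamma>})"
    have T: "finite T" "T \<subseteq> F" "T \<inter> l ` S = {}" "T \<subseteq> {\<gamma>}" "card S + card T = 4"
      using \<gamma> S by (auto simp: T_def)
    have card4: "card (l ` S \<union> T) = 4"
      using T \<open>finite S\<close> inj by (subst card_Un_disjoint) (auto simp: card_image)
    have "x i \<in> F" for i :: nat
      using x by (cases "i < 4") (auto simp: supported_def)
    moreover have "finite (l ` S \<union> T)" "l ` S \<union> T \<subseteq> F"
      using T(1,2) l(1) S(1) \<open>finite S\<close> by auto
    ultimately obtain \<xi> where \<xi>: "\<And>s. \<xi> s \<in> F"
      "\<And>i. i < 4 \<Longrightarrow> (\<Sum>s\<in>l ` S \<union> T. \<xi> s * s ^ i) = x i"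
      using vandermonde_solvable[of "l ` S \<union> T" x] card4 by auto
    let ?f = "\<lambda>c. (c, pvec (l c) (\<xi> (l c)))" and ?g = "\<lambda>\<beta>. (0 :: 'g, pvec \<beta> (\<xi> \<beta>))"
    have "sum ?f S \<in> sums_le ?D (card S)"
      using S(1) \<xi>(1) \<open>finite S\<close> by (intro sums_le_sum sums_le_member) (auto simp: D1_def)
    \<comment> \<open>A zero coefficient contributes the empty sum, as \<open>D2\<close> omits the
      zero column.\<close>
    moreover have "?g \<beta> \<in> sums_le ?D 1" if "\<beta> \<in> T" for \<beta>
    proof (cases "\<xi> \<beta> = 0")
      case False
      then show ?thesis
        using that T(4) \<xi>(1) by (intro sums_le_member) (auto simp: D2_def)
    qed (simp flip: zero_prod_def)
    then have "sum ?g T \<in> sums_le ?D (card T)"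
      using T(1) by (intro sums_le_sum) auto
    ultimately have in_sums: "sum ?f S + sum ?g T \<in> sums_le ?D 4"
      using T(5) by (intro sums_le_add) auto
    have "snd (sum ?f S + sum ?g T) = x"
    proof
      fix i
      have "snd (sum ?f S + sum ?g T) i
        = (\<Sum>c\<in>S. pvec (l c) (\<xi> (l c)) i) + (\<Sum>\<beta>\<in>T. pvec \<beta> (\<xi> \<beta>) i)"
        by (simp add: snd_sum sum_fun_apply)
      also have "\<dots> = (\<Sum>\<beta>\<in>l ` S \<union> T. pvec \<beta> (\<xi> \<beta>) i)"
        using T \<open>finite S\<close> inj
        by (subst sum.union_disjoint) (auto simp: sum.reindex)
      also have "\<dots> = x i"
        using \<xi>(2)[of i] x by (cases "i < 4") (simp_all add: pvec_def supported_def)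
      finally show "snd (sum ?f S + sum ?g T) i = x i" .
    qed
    moreover have "fst (sum ?f S + sum ?g T) = v"
      using S(4) by (simp add: fst_sum)
    ultimately have "sum ?f S + sum ?g T = (v, x)"
      by (intro prod_eqI) (simp_all only: fst_conv snd_conv)
    with in_sums show "(v, x) \<in> sums_le ?D 4"
      by simp
  qed
  \<comment> \<open>\<open>1\<close>, \<open>\<eta>\<close> and \<open>1 + \<eta>\<close> are the
    coefficients of a zero-sum triple with label \<open>\<gamma>\<close>.\<close>
  obtain \<eta> where \<eta>: "\<eta> \<in> F" "\<eta> \<noteq> 0" "\<eta> \<noteq> 1"
    using obtain_not_in[of "{0, 1}"] F by auto
  have mem: "(0, pvec \<gamma> \<zeta>) \<in> ?D" if "\<zeta> \<in> F" "\<zeta> \<noteq> 0" for \<zeta>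
    using that by (auto simp: D2_def)
  have "(0, pvec \<gamma> 1) + (0, pvec \<gamma> \<eta>) \<in> ?D"
    using mem[of "1 + \<eta>"] \<eta> by (auto simp: add_eq_0_iff_eq pvec_add)
  with \<eta> show thesis
    by (intro that[OF D_sub D_0 D_card cov_D mem mem]) auto
qed

end

section \<open>The base code of codimension 20\<close>

text \<open>With \<open>{0, 1}\<close> as the binary field inside \<open>'k\<close>,
  \<open>ind {j}\<close> is the unit column with label \<open>j\<close>, and \<open>ind F\<close> is
  the all-one column, which belongs to the label at infinity.\<close>

definition ind :: "'k set \<Rightarrow> 'k \<Rightarrow> 'k::field" where
  "ind J = (\<lambda>j. if j \<in> J then 1 else 0)"

text \<open>\<open>axis 3\<close> carries the multiples of the point at infinity of the twisted
  cubic.\<close>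

definition axis :: "nat \<Rightarrow> 'k::field \<Rightarrow> nat \<Rightarrow> 'k" where
  "axis k \<xi> = (\<lambda>i. if i = k then \<xi> else 0)"

lemma axis_0 [simp]: "axis k 0 = 0"
  by (simp add: axis_def fun_eq_iff)

lemma axis_add: "axis k (\<xi> + \<eta>) = axis k \<xi> + axis k \<eta>"
  by (auto simp: axis_def fun_eq_iff)

lemma axis_eq_iff [simp]: "axis k \<xi> = axis k \<eta> \<longleftrightarrow> \<xi> = \<eta>"
  by (auto simp: axis_def fun_eq_iff)

lemma axis_eq_0_iff [simp]: "axis k \<xi> = 0 \<longleftrightarrow> \<xi> = 0"
  by (auto simp: axis_def fun_eq_iff)

lemma axis_eq_axis_iff: "axis k \<xi> = axis l \<eta> \<longleftrightarrow> \<xi> = \<eta> \<and> (k = l \<or> \<xi> = 0)"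
  by (auto simp: axis_def fun_eq_iff)

lemma all_less_4: "(\<forall>i<4::nat. P i) \<longleftrightarrow> P 0 \<and> P 1 \<and> P 2 \<and> P 3"
  by (auto simp: numeral_eq_Suc All_less_Suc)

lemma supported_eqI:
  assumes "f \<in> supported {..<4::nat} A" "g \<in> supported {..<4} B"
    "f 0 = g 0" "f 1 = g 1" "f 2 = g 2" "f 3 = g 3"
  shows "f = g"
proof
  fix i
  have "\<forall>i<4. f i = g i"
    using assms by (simp add: all_less_4)
  then show "f i = g i"
    using assms(1,2) by (cases "i < 4") (auto simp: supported_def)
qed

lemma sum_pair: "(\<Sum>i\<in>A. (f i, g i)) = (sum f A, sum g A)"
  for f :: "'a \<Rightarrow> 'b::comm_monoid_add" and g :: "'a \<Rightarrow> 'c::comm_monoid_add"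
  by (simp add: prod_eq_iff fst_sum snd_sum)

lemma zero_pair_eq: "(0, 0) = 0"
  by (simp add: zero_prod_def)

lemma sum_ind: "finite J \<Longrightarrow> (\<Sum>j\<in>J. ind {j}) = ind J"
  by (auto simp: ind_def sum_fun_apply fun_eq_iff)

context finite_char2_subfield
begin

lemma axis_supported: "k < 4 \<Longrightarrow> \<xi> \<in> F \<Longrightarrow> axis k \<xi> \<in> supported {..<4::nat} F"
  by (auto simp: supported_def axis_def)

lemma supported_add:
  "f \<in> supported I F \<Longrightarrow> g \<in> supported I F \<Longrightarrow> f + g \<in> supported I F"
  using is_subgroup_supported[OF subgroup, of I] by (simp add: is_subgroup_def)

text \<open>The nodes in \<open>J\<close> control the first \<open>card J\<close> coordinates only;
  \<open>y\<close> is what further columns have to supply.\<close>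

lemma vandermonde_residual:
  assumes J: "finite J" "J \<subseteq> F" and x: "x \<in> supported {..<4::nat} F"
  shows "\<exists>\<xi> y. (\<forall>s. \<xi> s \<in> F) \<and> y \<in> supported {..<4::nat} F \<and> (\<forall>i<card J. y i = 0)
    \<and> x = (\<Sum>s\<in>J. pvec s (\<xi> s)) + y"
proof -
  have x': "x i \<in> F" for i
    using x by (cases "i < 4") (auto simp: supported_def)
  obtain \<xi> where \<xi>: "\<And>s. \<xi> s \<in> F" "\<And>i. i < card J \<Longrightarrow> (\<Sum>s\<in>J. \<xi> s * s ^ i) = x i"
    using vandermonde_solvable[of J x, OF J x'] by blast
  define z where "z = (\<Sum>s\<in>J. pvec s (\<xi> s))"
  have z: "z \<in> supported {..<4} F"
    unfolding z_def using J \<xi>(1)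
    by (intro is_subgroup_sum is_subgroup_supported subgroup pvec_supported) auto
  have "(z + x) i = 0" if "i < card J" for i
  proof (cases "i < 4")
    case True
    then show ?thesis
      using \<xi>(2)[OF that] by (simp add: z_def sum_fun_apply pvec_def)
  next
    case False
    then show ?thesis
      using x z by (simp add: supported_def)
  qed
  then show ?thesis
    using \<xi>(1) supported_add[OF z x] by (intro exI[of _ \<xi>] exI[of _ "z + x"]) (auto simp: z_def)
qed

end

text \<open>The conditions make \<open>1\<close>, \<open>q\<close>, \<open>d\<close> a basis of
  \<open>F\<close> over the prime field: \<open>{0, 1, q, 1 + q}\<close> is a plane and
  \<open>d\<close> lies outside it.\<close>

locale base_code = finite_char2_subfield F
  for F :: "'a::{field, elementary_2_group} set" +
  fixes q d :: 'a
  assumes card_F: "card F = 8"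
    and q: "q \<in> F" "q \<notin> {0, 1}"
    and d: "d \<in> F" "d \<notin> {0, 1, q, 1 + q}"
begin

text \<open>An affine plane \<open>Q\<close> avoiding 0 would also satisfy \<open>Q \<union> (Q + Q) = F\<close>, but then
  the sum of two of the columns \<open>(0, axis 1 c)\<close> would not be a sum of 3 or 4 columns.\<close>

abbreviation Q :: "'a set" where
  "Q \<equiv> {1, q, 1 + q, d}"

abbreviation V :: "(('a \<Rightarrow> 'a) \<times> (nat \<Rightarrow> 'a)) set" where
  "V \<equiv> supported F {0, 1} \<times> supported {..<4} F"

definition columns :: "(('a \<Rightarrow> 'a) \<times> (nat \<Rightarrow> 'a)) set" where
  "columns = (\<lambda>(j, \<xi>). (ind {j}, pvec j \<xi>)) ` (F \<times> F) \<union> (\<lambda>\<xi>. (ind F, axis 3 \<xi>)) ` F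
    \<union> (\<lambda>(k, \<xi>). (0, axis k \<xi>)) ` ({2, 3} \<times> (F - {0})) \<union> (\<lambda>\<xi>. (0, axis 1 \<xi>)) ` Q"

lemma Q_subset: "Q \<subseteq> F - {0}"
  using q d by (auto simp: add_eq_0_iff_eq)

lemma distinct_Q: "q \<noteq> 0" "q \<noteq> 1" "1 + q \<noteq> 0" "1 + q \<noteq> 1" "1 + q \<noteq> q" "d \<noteq> 0" "d \<noteq> 1"
    "d \<noteq> q" "d \<noteq> 1 + q"
  using q d by (auto simp: add_eq_0_iff_eq)

text \<open>The four families contribute 64, 8, 14 and 4.\<close>

lemma card_columns: "card columns \<le> 90"
proof -
  have "card columns \<le> card (F \<times> F) + card F + card ({2, 3 :: nat} \<times> (F - {0})) + card Q"
    unfolding columns_def using finite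
    by (intro order_trans[OF card_Un_le] add_mono card_image_le) auto
  also have "card Q = 4"
    using distinct_Q by simp
  finally show ?thesis
    using finite by (simp add: card_cartesian_product card_F)
qed

lemma finite_columns: "finite columns"
  using finite by (simp add: columns_def)

lemma ind_supported: "J \<subseteq> F \<Longrightarrow> ind J \<in> supported F {0, 1}"
  by (auto simp: supported_def ind_def)

lemma V_subgroup: "is_subgroup V"
proof (intro is_subgroup_Times is_subgroup_supported subgroup)
  show "is_subgroup {0, 1 :: 'a}"
    by (auto simp: is_subgroup_def simp del: one_add_one)
qed

lemma V_card: "finite V" "card V = 2 ^ 20"
  using finite card_F
  by (simp_all add: finite_supported card_cartesian_product card_supported flip: numeral_2_eq_2)

lemma columns_subset: "columns \<subseteq> V"
proof -
  have "0 \<in> supported F {0, 1 :: 'a}"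
    by (auto simp: supported_def)
  then show ?thesis
    using Q_subset by (auto simp: columns_def ind_supported pvec_supported axis_supported)
qed

lemma zero_notin_columns: "0 \<notin> columns"
proof -
  have ind: "ind J \<noteq> (0 :: 'a \<Rightarrow> 'a)" if "j \<in> J" for j J
    using that by (auto simp: ind_def fun_eq_iff)
  have "ind {j} \<noteq> (0 :: 'a \<Rightarrow> 'a)" "ind F \<noteq> (0 :: 'a \<Rightarrow> 'a)" for j
    using ind[of j "{j}"] ind[OF one] by auto
  then show ?thesis
    using Q_subset by (auto simp: columns_def prod_eq_iff)
qed

section \<open>Sums of at most four columns of the base code\<close>

lemma column_pvec: "j \<in> F \<Longrightarrow> \<xi> \<in> F \<Longrightarrow> (ind {j}, pvec j \<xi>) \<in> sums_le columns 1"
  by (intro sums_le_member) (auto simp: columns_def)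

lemma column_inf: "\<xi> \<in> F \<Longrightarrow> (ind F, axis 3 \<xi>) \<in> sums_le columns 1"
  by (intro sums_le_member) (auto simp: columns_def)

lemma column_axis: "k \<in> {2, 3} \<Longrightarrow> \<xi> \<in> F \<Longrightarrow> (0, axis k \<xi>) \<in> sums_le columns 1"
  by (cases "\<xi> = 0") (auto simp: columns_def zero_pair_eq intro!: sums_le_member)

lemma column_axis_1: "\<xi> \<in> insert 0 Q \<Longrightarrow> (0, axis 1 \<xi>) \<in> sums_le columns 1"
  by (cases "\<xi> = 0") (auto simp: columns_def zero_pair_eq intro!: sums_le_member)

text \<open>\<open>F\<close> consists of the plane \<open>?W\<close>, contained in
  \<open>insert 0 Q\<close>, and its coset through \<open>d\<close>.\<close>

lemma sum_two_Q:
  assumes "\<xi> \<in> F"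
  obtains a b where "a \<in> insert 0 Q" "b \<in> insert 0 Q" "\<xi> = a + b"
proof -
  let ?W = "{0, 1, q, 1 + q}"
  have "card ?W = 4"
    using distinct_Q by simp
  have closed: "x + y \<in> ?W" if "x \<in> ?W" "y \<in> ?W" for x y
    using that by (auto simp: add_ac simp del: one_add_one)
  have disjoint: "(+) d ` ?W \<inter> ?W = {}"
  proof (intro equals0I)
    fix z assume "z \<in> (+) d ` ?W \<inter> ?W"
    then obtain x where x: "d + x \<in> ?W" "x \<in> ?W"
      by blast
    show False
      using closed[OF x] d(2) by (simp only: add.assoc add_self add_0_right)
  qed
  have "?W \<union> (+) d ` ?W = F"
  proof (rule card_subset_eq[OF finite])
    show "?W \<union> (+) d ` ?W \<subseteq> F"
      using q d by auto
    have "card (?W \<union> (+) d ` ?W) = card ?W + card ((+) d ` ?W)"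
      by (intro card_Un_disjoint) (use disjoint in \<open>simp_all only: finite.intros finite_imageI Int_commute\<close>)
    also have "card ((+) d ` ?W) = card ?W"
      by (intro card_image inj_onI) simp
    finally show "card (?W \<union> (+) d ` ?W) = card F"
      using \<open>card ?W = 4\<close> card_F by simp
  qed
  then have "\<xi> \<in> ?W \<union> (+) d ` ?W"
    using assms by blast
  then show thesis
    using that[of \<xi> 0] that[of d] by auto
qed

lemma column_axis_1_twice:
  assumes "\<xi> \<in> F"
  shows "(0, axis 1 \<xi>) \<in> sums_le columns 2"
proof -
  obtain a b where "a \<in> insert 0 Q" "b \<in> insert 0 Q" "\<xi> = a + b"
    using sum_two_Q[OF assms] .
  then have "(0, axis 1 a) + (0, axis 1 b) \<in> sums_le columns 2"
    by (intro sums_le_add[of _ _ 1 _ 1] column_axis_1) auto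
  then show ?thesis
    using \<open>\<xi> = a + b\<close> by (simp add: axis_add)
qed

lemma columns_pvec_twice:
  assumes "j \<in> F" "\<xi> \<in> F"
  shows "(0, pvec j \<xi>) \<in> sums_le columns 2"
proof -
  have "(ind {j}, pvec j \<xi>) + (ind {j}, pvec j 0) \<in> sums_le columns 2"
    using assms by (intro sums_le_add[of _ _ 1 _ 1] column_pvec) auto
  then show ?thesis
    by simp
qed

text \<open>Up to the last coordinate, which one more column \<open>(0, axis 3 b)\<close> or \<open>(ind F, axis 3 b)\<close>
  can correct, three columns suffice.\<close>

lemma three_columns:
  assumes J: "J \<subseteq> F" "card J \<le> 3" and x: "x \<in> supported {..<4} F"
  shows "\<exists>b\<in>F. (ind J, x + axis 3 b) \<in> sums_le columns 3"
proof -
  have "finite J"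
    using J(1) finite finite_subset by blast
  obtain \<xi> y where \<xi>: "\<And>s. \<xi> s \<in> F" and y: "y \<in> supported {..<4} F"
    "\<And>i. i < card J \<Longrightarrow> y i = 0" and xy: "x = (\<Sum>s\<in>J. pvec s (\<xi> s)) + y"
    using vandermonde_residual[OF \<open>finite J\<close> J(1) x] by blast
  have yF: "y 0 \<in> F" "y 1 \<in> F" "y 2 \<in> F" "y 3 \<in> F"
    using y(1) by (auto simp: supported_def)
  have "(\<Sum>s\<in>J. (ind {s}, pvec s (\<xi> s))) \<in> sums_le columns (card J)"
    using J(1) \<xi> \<open>finite J\<close> by (intro sums_le_sum column_pvec) auto
  then have J_in: "(ind J, \<Sum>s\<in>J. pvec s (\<xi> s)) \<in> sums_le columns (card J)"
    using \<open>finite J\<close> by (simp add: sum_pair sum_ind)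
  have residual: ?thesis if "b \<in> F" "(0, y + axis 3 b) \<in> sums_le columns k" "card J + k \<le> 3" for b k
    using sums_le_add[OF J_in that(2,3)] that(1) by (intro bexI[of _ b]) (simp_all add: xy add.assoc)
  note supp = supported_add pvec_supported axis_supported
  \<comment> \<open>The columns not spent on the nodes in \<open>J\<close> must supply the residue
    \<open>y\<close>, up to its last coordinate.\<close>
  consider "card J = 0" "y 0 = 0" | "card J = 0" "y 0 \<noteq> 0"
    | "card J = 1" "y 1 \<in> insert 0 Q" | "card J = 1" "y 2 = 0" | "card J = 1" "y 1 \<noteq> 0" "y 2 \<noteq> 0"
    | "card J = 2" | "card J = 3"
    using J(2) by fastforce
  then show ?thesis
  proof cases
    case 1
    have "(0, axis 1 (y 1)) + (0, axis 2 (y 2)) \<in> sums_le columns 3"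
      using yF by (intro sums_le_add[OF column_axis_1_twice column_axis]) auto
    moreover have "y + axis 3 (y 3) = axis 1 (y 1) + axis 2 (y 2)"
      using 1 y(1) yF by (intro supported_eqI[of _ F _ F] supp) (auto simp: axis_def)
    ultimately show ?thesis
      using 1 yF by (intro residual[of "y 3" 3]) simp_all
  next
    case 2
    \<comment> \<open>\<open>pvec k (y 0)\<close> agrees with \<open>y\<close> in coordinates 0 and
      1 and costs two columns; \<open>a\<close> and \<open>b\<close> are the defects in coordinates
      2 and 3.\<close>
    define k where "k = y 1 / y 0"
    define a where "a = y 2 + y 0 * k ^ 2"
    define b where "b = y 3 + y 0 * k ^ 3"
    have F: "k \<in> F" "a \<in> F" "b \<in> F"
      using yF unfolding k_def a_def b_def by blast+
    have "(0, pvec k (y 0)) + (0, axis 2 a) \<in> sums_le columns 3"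
      using F yF by (intro sums_le_add[OF columns_pvec_twice column_axis]) auto
    moreover have "y + axis 3 b = pvec k (y 0) + axis 2 a"
      using 2 y(1) yF F
      by (intro supported_eqI[of _ F _ F] supp)
        (auto simp: axis_def pvec_def k_def a_def b_def algebra_simps)
    ultimately show ?thesis
      using 2 F by (intro residual[of b 3]) simp_all
  next
    case 3
    have "(0, axis 1 (y 1)) + (0, axis 2 (y 2)) \<in> sums_le columns 2"
      using yF 3 by (intro sums_le_add[OF column_axis_1 column_axis]) auto
    moreover have "y + axis 3 (y 3) = axis 1 (y 1) + axis 2 (y 2)"
      using 3 y yF by (intro supported_eqI[of _ F _ F] supp) (auto simp: axis_def)
    ultimately show ?thesis
      using 3 yF by (intro residual[of "y 3" 2]) simp_all
  next
    case 4
    have "(0, axis 1 (y 1)) \<in> sums_le columns 2"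
      using yF by (intro column_axis_1_twice) auto
    moreover have "y + axis 3 (y 3) = axis 1 (y 1)"
      using 4 y yF by (intro supported_eqI[of _ F _ F] supp) (auto simp: axis_def)
    ultimately show ?thesis
      using 4 yF by (intro residual[of "y 3" 2]) simp_all
  next
    case 5
    then obtain j where j: "J = {j}" "j \<in> F"
      using J(1) by (auto simp: card_1_singleton_iff)
    \<comment> \<open>Since \<open>j ^ 2 + k ^ 2 = (j + k) ^ 2\<close>, agreement of
      \<open>pvec j \<zeta> + pvec k \<zeta>\<close> with \<open>y\<close> in coordinates 1 and 2
      means \<open>\<zeta> * (j + k) = y 1\<close> and \<open>y 1 * (j + k) = y 2\<close>. The
      column labelled \<open>j\<close> absorbs \<open>pvec j \<zeta>\<close>, so only the pair for
      \<open>k\<close> is added.\<close>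
    define k where "k = j + y 2 / y 1"
    define \<zeta> where "\<zeta> = y 1 / (j + k)"
    define b where "b = y 3 + \<zeta> * (j ^ 3 + k ^ 3)"
    have F: "k \<in> F" "\<zeta> \<in> F" "b \<in> F"
      using yF j(2) unfolding k_def \<zeta>_def b_def by blast+
    have "j + k \<noteq> 0"
      using 5 by (simp add: k_def add_eq_0_iff_eq)
    then have \<zeta>: "\<zeta> * (j + k) = y 1"
      by (simp add: \<zeta>_def)
    have jk: "y 1 * (j + k) = y 2"
      using 5 by (simp add: k_def)
    have "\<zeta> * (j ^ 2 + k ^ 2) = \<zeta> * (j + k) * (j + k)"
      by (simp add: algebra_simps power2_eq_square)
    then have \<zeta>2: "\<zeta> * (j ^ 2 + k ^ 2) = y 2"
      by (simp only: \<zeta> jk)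
    have "y + axis 3 b = pvec j \<zeta> + pvec k \<zeta>"
      using 5 y yF F j(2) \<zeta> \<zeta>2
      by (intro supported_eqI[of _ F _ F] supp) (auto simp: axis_def pvec_def b_def algebra_simps)
    then have "x + axis 3 b = pvec j (\<xi> j + \<zeta>) + pvec k \<zeta>"
      by (simp add: xy j(1) pvec_add add.assoc)
    moreover have "(ind {j}, pvec j (\<xi> j + \<zeta>)) + (0, pvec k \<zeta>) \<in> sums_le columns 3"
      using F \<xi> j(2) by (intro sums_le_add[OF column_pvec columns_pvec_twice]) auto
    ultimately show ?thesis
      using F(3) j(1) by (intro bexI[of _ b]) simp_all
  next
    case 6
    have "(0, axis 2 (y 2)) \<in> sums_le columns 1"
      using yF by (intro column_axis) auto
    moreover have "y + axis 3 (y 3) = axis 2 (y 2)"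
      using 6 y yF by (intro supported_eqI[of _ F _ F] supp) (auto simp: axis_def)
    ultimately show ?thesis
      using 6 yF by (intro residual[of "y 3" 1]) simp_all
  next
    case 7
    have "y + axis 3 (y 3) = 0"
      using 7 y yF by (intro supported_eqI[of _ F _ F] supp) (auto simp: axis_def supported_def)
    then show ?thesis
      using 7 yF by (intro residual[of "y 3" 0]) (simp_all add: zero_pair_eq)
  qed
qed

text \<open>For weight of \<open>h\<close> at most 3, a fourth column repairs the last coordinate.
  Weight 4 gives four nodes and no residue. For larger weight, a column over \<open>ind F\<close>
  both passes to the complement, of weight at most 3, and repairs the last coordinate.\<close>

lemma four_columns: "V \<subseteq> sums_le columns 4"
proof safe
  fix h :: "'a \<Rightarrow> 'a" and x :: "nat \<Rightarrow> 'a"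
  assume h: "h \<in> supported F {0, 1}" and x: "x \<in> supported {..<4} F"
  define J where "J = {j \<in> F. h j = 1}"
  have J: "J \<subseteq> F" "finite J" "h = ind J"
    using h finite by (auto simp: J_def ind_def supported_def fun_eq_iff)
  consider "card J \<le> 3" | "card J = 4" | "5 \<le> card J"
    by linarith
  then show "(h, x) \<in> sums_le columns 4"
  proof cases
    case 1
    obtain b where b: "b \<in> F" "(ind J, x + axis 3 b) \<in> sums_le columns 3"
      using three_columns[OF J(1) 1 x] by blast
    then have "(ind J, x + axis 3 b) + (0, axis 3 b) \<in> sums_le columns 4"
      by (intro sums_le_add[OF _ column_axis]) auto
    then show ?thesis
      by (simp add: J(3) add.assoc)
  next
    case 2
    obtain \<xi> y where \<xi>: "\<And>s. \<xi> s \<in> F" and y: "y \<in> supported {..<4} F"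
      "\<And>i. i < card J \<Longrightarrow> y i = 0" and xy: "x = (\<Sum>s\<in>J. pvec s (\<xi> s)) + y"
      using vandermonde_residual[OF J(2,1) x] by blast
    have "y = 0"
      using y 2 by (intro supported_eqI[of _ F _ F]) (auto simp: supported_def)
    moreover have "(\<Sum>s\<in>J. (ind {s}, pvec s (\<xi> s))) \<in> sums_le columns 4"
      using J(1,2) \<xi> 2 by (intro sums_le_sum column_pvec) auto
    ultimately show ?thesis
      using J(2) by (simp add: xy J(3) sum_pair sum_ind)
  next
    case 3
    then have "card (F - J) \<le> 3"
      using J card_F by (simp add: card_Diff_subset)
    then obtain b where b: "b \<in> F" "(ind (F - J), x + axis 3 b) \<in> sums_le columns 3"
      using three_columns[of "F - J", OF _ _ x] by blast
    then have "(ind (F - J), x + axis 3 b) + (ind F, axis 3 b) \<in> sums_le columns 4"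
      by (intro sums_le_add[OF _ column_inf]) auto
    moreover have "ind (F - J) + ind F = ind J"
      using J(1) by (auto simp: ind_def fun_eq_iff simp del: one_add_one)
    ultimately show ?thesis
      by (simp add: J(3) add.assoc)
  qed
qed

text \<open>Three further points of an affine line through \<open>line \<xi>\<close> sum up to \<open>line \<xi>\<close>.\<close>

lemma replace_on_line:
  assumes "\<And>\<xi>. \<xi> \<in> F \<Longrightarrow> (t, g \<xi>) \<in> columns" "\<And>\<xi> \<eta>. g (\<xi> + \<eta>) = g \<xi> + g \<eta>" "inj_on g F"
    and "\<xi> \<in> F"
  shows "\<exists>S\<subseteq>columns. 2 \<le> card S \<and> card S \<le> 3 \<and> \<Sum>S = (t, g \<xi>) \<and> h' \<notin> S"
proof -
  \<comment> \<open>\<open>\<xi>'\<close> is the parameter of \<open>h'\<close>, or 0 if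
    \<open>h'\<close> is not on the line.\<close>
  obtain \<xi>' where \<xi>': "\<xi>' \<in> F" "\<And>\<eta>. \<eta> \<in> F \<Longrightarrow> \<eta> \<noteq> \<xi>' \<Longrightarrow> (t, g \<eta>) \<noteq> h'"
  proof (cases "\<exists>\<xi>'\<in>F. h' = (t, g \<xi>')")
    case True
    then show ?thesis
      using that assms(3) by (auto simp: inj_on_eq_iff)
  next
    case False
    then show ?thesis
      using that zero by metis
  qed
  have small: "card {0, \<xi> + \<xi>'} < card F"
    using card_F card_insert_le_m1[of 2 "{\<xi> + \<xi>'}" 0] by simp
  obtain a where a: "a \<in> F" "a \<notin> {0, \<xi> + \<xi>'}"
    using obtain_not_in[OF _ small] by auto
  \<comment> \<open>The exclusions make \<open>a\<close>, \<open>b\<close>, \<open>a + b\<close>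
    distinct and nonzero and keep \<open>\<xi>'\<close> out of \<open>?T\<close>.\<close>
  have small: "card {0, a, \<xi> + \<xi>', \<xi> + \<xi>' + a} < card F"
    using card_F card_length[of "[0, a, \<xi> + \<xi>', \<xi> + \<xi>' + a]"] by simp
  obtain b where b: "b \<in> F" "b \<notin> {0, a, \<xi> + \<xi>', \<xi> + \<xi>' + a}"
    using obtain_not_in[OF _ small] by auto
  let ?T = "{\<xi> + a, \<xi> + b, \<xi> + (a + b)}"
  have avoid: "\<xi>' \<noteq> \<xi> + c" if "c \<noteq> \<xi> + \<xi>'" for c
    using that by (metis add_self_left)
  have "a + b \<noteq> \<xi> + \<xi>'"
    using b(2) by (metis add_self_left add.commute insertCI)
  then have "\<xi>' \<notin> ?T"
    using a(2) b(2) by (simp add: avoid)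
  have ne: "a \<noteq> 0" "b \<noteq> 0" "a \<noteq> b"
    using a b by auto
  then have T: "?T \<subseteq> F" "card ?T = 3"
    using a(1) b(1) assms(4) by auto
  let ?f = "\<lambda>\<eta>. (t, g \<eta>)"
  have inj: "inj_on ?f ?T"
    using inj_on_subset[OF assms(3) T(1)] unfolding inj_on_def by blast
  define S where "S = ?f ` ?T"
  have "\<Sum>S = sum ?f ?T"
    unfolding S_def using inj by (subst sum.reindex) simp_all
  also have "\<dots> = ?f \<xi>"
    using ne by (simp add: assms(2) add_ac)
  finally have "\<Sum>S = ?f \<xi>" .
  moreover have "card S = 3"
    unfolding S_def using card_image[OF inj] T(2) by (rule trans)
  moreover have "S \<subseteq> columns" "h' \<notin> S"
    unfolding S_def using assms(1) T(1) \<xi>'(2) \<open>\<xi>' \<notin> ?T\<close> by blast+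
  ultimately show ?thesis
    by (intro exI[of _ S]) simp
qed

lemma axis_column: "k \<in> {2, 3} \<Longrightarrow> \<xi> \<in> F \<Longrightarrow> \<xi> \<noteq> 0 \<Longrightarrow> (0, axis k \<xi>) \<in> columns"
  by (auto simp: columns_def)

lemma axis_1_column: "\<xi> \<in> Q \<Longrightarrow> (0, axis 1 \<xi>) \<in> columns"
  by (auto simp: columns_def)

text \<open>The parameter 0 gives no column here, so two points replace the three on a full line:
  \<open>\<xi>\<close> is split as \<open>a + (\<xi> + a)\<close>, both parts nonzero and different
  from the parameter of \<open>h'\<close>.\<close>

lemma replace_axis:
  assumes "k \<in> {2, 3}" "\<xi> \<in> F" "\<xi> \<noteq> 0"
  shows "\<exists>S\<subseteq>columns. 2 \<le> card S \<and> card S \<le> 3 \<and> \<Sum>S = (0, axis k \<xi>) \<and> h' \<notin> S"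
proof -
  obtain \<xi>' where \<xi>': "\<xi>' \<in> F" "\<And>\<eta>. \<eta> \<in> F \<Longrightarrow> \<eta> \<noteq> \<xi>' \<Longrightarrow> (0, axis k \<eta>) \<noteq> h'"
  proof (cases "\<exists>\<xi>'\<in>F. h' = (0, axis k \<xi>')")
    case True
    then show ?thesis
      using that by auto
  next
    case False
    then show ?thesis
      using that zero by metis
  qed
  have small: "card {0, \<xi>, \<xi>', \<xi> + \<xi>'} < card F"
    using card_F card_length[of "[0, \<xi>, \<xi>', \<xi> + \<xi>']"] by simp
  obtain a where a: "a \<in> F" "a \<notin> {0, \<xi>, \<xi>', \<xi> + \<xi>'}"
    using obtain_not_in[OF _ small] by auto
  have a': "\<xi> + a \<in> F" "\<xi> + a \<noteq> 0" "\<xi> + a \<noteq> \<xi>'" "a \<noteq> \<xi> + a"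
    using a assms by (auto simp: add_eq_0_iff_eq)
  define S where "S = {(0 :: 'a \<Rightarrow> 'a, axis k a), (0, axis k (\<xi> + a))}"
  have "card S = 2" "\<Sum>S = (0, axis k \<xi>)"
    unfolding S_def using a' by (simp_all add: axis_add add_ac)
  moreover have "S \<subseteq> columns" "h' \<notin> S"
    unfolding S_def using assms a a' \<xi>'(2)[of a] \<xi>'(2)[of "\<xi> + a"] by (auto intro: axis_column)
  ultimately show ?thesis
    by (intro exI[of _ S]) simp
qed

lemma sum_in_subplane:
  assumes "a \<in> {1, q, 1 + q}" "b \<in> {1, q, 1 + q}" "a \<noteq> b"
  shows "a + b \<in> {1, q, 1 + q}"
  using assms by (auto simp: add_ac simp del: one_add_one)

text \<open>Adding such a triple lengthens a sum without changing it.\<close>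

lemma zero_triple:
  assumes "k \<in> {2, 3}"
  defines "Z \<equiv> {(0 :: 'a \<Rightarrow> 'a, axis k 1), (0, axis k q), (0, axis k (1 + q))}"
  shows "Z \<subseteq> columns" "finite Z" "card Z = 3" "\<Sum>Z = 0"
proof -
  show "Z \<subseteq> columns"
    using assms q distinct_Q by (auto intro!: axis_column)
  show "finite Z" "card Z = 3"
    using distinct_Q by (simp_all add: Z_def)
  show "\<Sum>Z = 0"
    using distinct_Q by (simp add: Z_def axis_add add_ac zero_pair_eq)
qed

lemma pvec_column: "j \<in> F \<Longrightarrow> \<xi> \<in> F \<Longrightarrow> (ind {j}, pvec j \<xi>) \<in> columns"
  by (auto simp: columns_def)

lemma inf_column: "\<xi> \<in> F \<Longrightarrow> (ind F, axis 3 \<xi>) \<in> columns"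
  by (auto simp: columns_def)

text \<open>One of the two columns is replaced by two or three columns that avoid the other. Only
  two columns on axis 1 need a separate argument.\<close>

lemma pair_of_columns:
  assumes h: "h \<in> columns" "h' \<in> columns" "h \<noteq> h'"
  shows "\<exists>S\<subseteq>columns. 3 \<le> card S \<and> card S \<le> 4 \<and> \<Sum>S = h + h'"
proof -
  have extend: ?thesis
    if ex: "\<exists>S\<subseteq>columns. 2 \<le> card S \<and> card S \<le> 3 \<and> \<Sum>S = x \<and> y \<notin> S"
      and y: "y \<in> columns" "x + y = h + h'" for x y
  proof -
    obtain S where S: "S \<subseteq> columns" "2 \<le> card S" "card S \<le> 3" "\<Sum>S = x" "y \<notin> S"
      using ex by blast
    moreover have "finite S"
      using S(1) finite_columns finite_subset by blast
    ultimately show ?thesis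
      using y by (intro exI[of _ "insert y S"]) (simp add: add.commute)
  qed
  have replace: "(\<exists>S\<subseteq>columns. 2 \<le> card S \<and> card S \<le> 3 \<and> \<Sum>S = x \<and> y \<notin> S) \<or> x \<in> (\<lambda>\<xi>. (0, axis 1 \<xi>)) ` Q"
    if x: "x \<in> columns" for x y
  proof -
    consider "x \<in> (\<lambda>(j, \<xi>). (ind {j}, pvec j \<xi>)) ` (F \<times> F)" | "x \<in> (\<lambda>\<xi>. (ind F, axis 3 \<xi>)) ` F"
      | "x \<in> (\<lambda>(k, \<xi>). (0, axis k \<xi>)) ` ({2, 3} \<times> (F - {0}))" | "x \<in> (\<lambda>\<xi>. (0, axis 1 \<xi>)) ` Q"
      using x unfolding columns_def by (elim UnE)
    then show ?thesis
    proof cases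
      case 1
      then obtain j \<xi> where "j \<in> F" "\<xi> \<in> F" "x = (ind {j}, pvec j \<xi>)"
        by auto
      then show ?thesis
        using replace_on_line[of "ind {j}" "pvec j" \<xi> y] pvec_column
        by (simp add: pvec_add inj_on_def)
    next
      case 2
      then obtain \<xi> where "\<xi> \<in> F" "x = (ind F, axis 3 \<xi>)"
        by auto
      then show ?thesis
        using replace_on_line[of "ind F" "axis 3" \<xi> y] inf_column
        by (simp add: axis_add inj_on_def)
    next
      case 3
      then obtain k \<xi> where "k \<in> {2, 3}" "\<xi> \<in> F" "\<xi> \<noteq> 0" "x = (0, axis k \<xi>)"
        by auto
      then show ?thesis
        using replace_axis[of k \<xi> y] by simp
    qed simp
  qed
  show ?thesis
  proof (cases "h \<in> (\<lambda>\<xi>. (0, axis 1 \<xi>)) ` Q \<and> h' \<in> (\<lambda>\<xi>. (0, axis 1 \<xi>)) ` Q")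
    case False
    then show ?thesis
      using replace[OF h(1), of h'] replace[OF h(2), of h] extend[of h h'] extend[of h' h] h
      by (metis add.commute)
  next
    case True
    then obtain a b where ab: "a \<in> Q" "b \<in> Q" "h = (0, axis 1 a)" "h' = (0, axis 1 b)"
      by blast
    then have "a \<noteq> b"
      using h(3) by blast
    \<comment> \<open>\<open>c\<close> is the sum of the other two nonzero elements of the plane,
      neither of which is \<open>d\<close>.\<close>
    have to_d: "\<exists>S\<subseteq>columns. 2 \<le> card S \<and> card S \<le> 3 \<and> \<Sum>S = (0, axis 1 c) \<and> (0, axis 1 d) \<notin> S"
      if c: "c \<in> {1, q, 1 + q}" for c
    proof -
      obtain a b where "a \<in> {1, q, 1 + q}" "b \<in> {1, q, 1 + q}" "a \<noteq> b" "c = a + b"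
        using c distinct_Q
        by (elim insertE emptyE) (metis add_self_left add.commute insertCI)+
      then show ?thesis
        using distinct_Q axis_1_column
        by (intro exI[of _ "{(0, axis 1 a), (0, axis 1 b)}"]) (auto simp: axis_add)
    qed
    consider "a = d" "b \<in> {1, q, 1 + q}" | "b = d" "a \<in> {1, q, 1 + q}"
      | "a \<in> {1, q, 1 + q}" "b \<in> {1, q, 1 + q}"
      using ab(1,2) \<open>a \<noteq> b\<close> by blast
    then show ?thesis
    proof cases
      case 1
      then show ?thesis
        using extend[OF to_d[of b]] ab h by (simp add: add.commute)
    next
      case 2
      then show ?thesis
        using extend[OF to_d[of a]] ab h by simp
    next
      case 3
      \<comment> \<open>Here \<open>a + b\<close> lies in \<open>Q\<close> again, so the pair
        becomes one column, lengthened by a triple on another axis.\<close>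
      define Z where "Z = {(0 :: 'a \<Rightarrow> 'a, axis 2 1), (0, axis 2 q), (0, axis 2 (1 + q))}"
      have Z: "Z \<subseteq> columns" "finite Z" "card Z = 3" "\<Sum>Z = 0"
        unfolding Z_def by (rule zero_triple; simp)+
      have ab_Q: "a + b \<in> {1, q, 1 + q}"
        using sum_in_subplane[OF 3 \<open>a \<noteq> b\<close>] .
      then have "(0, axis 1 (a + b)) \<notin> Z"
        using distinct_Q by (auto simp: Z_def axis_eq_axis_iff)
      then have "card (insert (0, axis 1 (a + b)) Z) = 4"
        "\<Sum>(insert (0, axis 1 (a + b)) Z) = h + h'"
        using Z(2,3,4) by (simp_all add: ab(3,4) axis_add)
      moreover have "(0, axis 1 (a + b)) \<in> columns"
        using ab_Q by (intro axis_1_column) blast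
      ultimately show ?thesis
        using Z(1) by (intro exI[of _ "insert (0, axis 1 (a + b)) Z"]) simp
    qed
  qed
qed

text \<open>Shorter sums are lengthened: none or one column by a zero-sum triple, two by
  replacement.\<close>

lemma three_or_four_columns:
  assumes "v \<in> V"
  shows "\<exists>S\<subseteq>columns. 3 \<le> card S \<and> card S \<le> 4 \<and> \<Sum>S = v"
proof -
  have "v \<in> sums_le columns 4"
    using four_columns assms by (rule subsetD)
  then obtain S where S: "S \<subseteq> columns" "finite S" "card S \<le> 4" "v = \<Sum>S"
    by (rule sums_leE)
  define Z where "Z k = {(0 :: 'a \<Rightarrow> 'a, axis k 1), (0, axis k q), (0, axis k (1 + q))}" for k
  have Z: "Z k \<subseteq> columns" "finite (Z k)" "card (Z k) = 3" "\<Sum>(Z k) = 0" if "k \<in> {2, 3}" for k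
    unfolding Z_def using zero_triple[OF that] by simp_all
  have disjoint: "Z 2 \<inter> Z 3 = {}"
    using distinct_Q by (auto simp: Z_def axis_eq_axis_iff)
  consider "card S = 0" | "card S = 1" | "card S = 2" | "3 \<le> card S"
    by linarith
  then show ?thesis
  proof cases
    case 1
    then show ?thesis
      using S Z[of 2] by (intro exI[of _ "Z 2"]) simp
  next
    case 2
    then obtain h where h: "S = {h}"
      by (auto simp: card_1_singleton_iff)
    \<comment> \<open>The triples on the two axes are disjoint, so one of them avoids
      \<open>h\<close>.\<close>
    obtain k where "k \<in> {2, 3}" "h \<notin> Z k"
      using disjoint by blast
    then show ?thesis
      using S(1,4) h Z[of k] by (intro exI[of _ "insert h (Z k)"]) simp
  next
    case 3
    then obtain h h' where "S = {h, h'}" "h \<noteq> h'"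
      by (auto simp: card_2_iff)
    then show ?thesis
      using S(1,4) pair_of_columns[of h h'] by simp
  next
    case 4
    then show ?thesis
      using S by blast
  qed
qed

end

section \<open>Fields with \<open>2 ^ m\<close> elements\<close>

instance bit :: elementary_2_group
  by standard simp

instance alg_closure :: ("{field, elementary_2_group}") elementary_2_group
proof
  fix x :: "'a alg_closure"
  have "(1 :: 'a alg_closure) + 1 = to_ac (1 + 1)"
    by (simp only: to_ac_add to_ac_1)
  also have "\<dots> = 0"
    by (simp only: add_self to_ac_0)
  finally have "x * (1 + 1) = 0"
    by (simp only: mult_zero_right)
  then show "x + x = 0"
    by (simp only: distrib_left mult_1_right)
qed

lemma freshmans_dream_2_power: "(x + y) ^ 2 ^ m = x ^ 2 ^ m + y ^ 2 ^ m"
  for x y :: "'k::{field, elementary_2_group}"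
proof (induction m)
  case (Suc m)
  have double: "z ^ 2 ^ Suc m = (z ^ 2 ^ m) ^ 2" for z :: 'k
    by (simp only: power_Suc2 power_mult)
  have square: "(a + b) ^ 2 = a ^ 2 + b ^ 2" for a b :: 'k
    by (simp add: power2_eq_square distrib_left distrib_right mult.commute add.assoc)
  show ?case
    unfolding double Suc square ..
qed simp

text \<open>The fixed points of the \<open>m\<close>-th iterate of the Frobenius map in
  characteristic 2.\<close>

definition fixed_field :: "nat \<Rightarrow> 'k::field set" where
  "fixed_field m = {x. x ^ 2 ^ m = x}"

text \<open>The elements are the roots of \<open>X ^ q + X\<close>, which splits over an
  algebraically closed field; its derivative is 1, so no root is multiple.\<close>

lemma card_fixed_field:
  assumes "0 < m"
  shows "finite (fixed_field m :: 'k::{alg_closed_field, elementary_2_group} set)"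
    and "card (fixed_field m :: 'k set) = 2 ^ m"
proof -
  define q :: nat where "q = 2 ^ m"
  define p :: "'k poly" where "p = monom 1 q + monom 1 1"
  have q: "1 < q"
    using assms one_less_power[of "2 :: nat" m] by (simp add: q_def)
  have "(of_nat q :: 'k) = 0"
  proof -
    have "even q"
      using assms by (simp add: q_def)
    then show ?thesis
      by (auto elim!: evenE simp: mult_2)
  qed
  then have pderiv: "pderiv p = 1"
    by (simp add: p_def pderiv_add pderiv_monom monom_0)
  have deg: "Polynomial.degree p = q"
    unfolding p_def using q by (subst degree_add_eq_left) (simp_all add: degree_monom_eq)
  then have "p \<noteq> 0"
    using q by auto
  obtain A where A: "size A = q" "p = smult (lead_coeff p) (\<Prod>x\<in>#A. [:- x, 1:])"
    using alg_closed_imp_factorization[OF \<open>p \<noteq> 0\<close>] deg by auto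
  have lc: "lead_coeff p \<noteq> 0"
    using \<open>p \<noteq> 0\<close> by simp
  have "poly p x = lead_coeff p * (\<Prod>a\<in>#A. x - a)" for x
    by (subst A(2)) (simp add: poly_prod_mset image_mset.compositionality comp_def)
  then have roots: "poly p x = 0 \<longleftrightarrow> x \<in># A" for x
    using lc by (auto simp: prod_mset_zero_iff)
  have "count A x \<le> 1" for x
  proof (rule ccontr)
    assume "\<not> count A x \<le> 1"
    then have "replicate_mset 2 x \<subseteq># A"
      by (simp flip: count_le_replicate_mset_subset_eq)
    then obtain B where "A = {#x, x#} + B"
      by (auto simp: numeral_2_eq_2 subset_mset.le_iff_add)
    then have "p = [:- x, 1:] * ([:- x, 1:] * smult (lead_coeff p) (\<Prod>x\<in>#B. [:- x, 1:]))"
      using A(2) by simp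
    then have "pderiv p = pderiv ([:- x, 1:] * ([:- x, 1:] * smult (lead_coeff p) (\<Prod>x\<in>#B. [:- x, 1:])))"
      by (rule arg_cong)
    then have "poly (pderiv p) x = 0"
      by (simp only: pderiv_mult poly_add poly_mult) simp
    then show False
      using pderiv by simp
  qed
  then have "mset_set (set_mset A) = A"
    by (intro multiset_eqI) (metis count_eq_zero_iff count_mset_set(1,3) finite_set_mset
        le_antisym less_one linorder_not_le)
  then have "card (set_mset A) = q"
    using A(1) by (metis size_mset_set)
  moreover have "fixed_field m = set_mset A"
    using roots by (auto simp: fixed_field_def p_def poly_monom q_def add_eq_0_iff_eq)
  ultimately show "finite (fixed_field m :: 'k set)" "card (fixed_field m :: 'k set) = 2 ^ m"
    by (simp_all add: q_def)
qed

lemma finite_char2_subfield_fixed_field: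
  assumes "0 < m"
  shows "finite_char2_subfield (fixed_field m :: 'k::{alg_closed_field, elementary_2_group} set)"
  by standard (use card_fixed_field[OF assms] in
      \<open>auto simp: fixed_field_def freshmans_dream_2_power power_mult_distrib power_inverse zero_power\<close>)

section \<open>The code of codimension \<open>4 t\<close>\<close>

lemma code_exists:
  assumes t: "12 \<le> t"
  shows "\<exists>H. is_code_RL (2944 * 2 ^ (t - 10) - 3) (4 * t) 3 4 2 H"
proof -
  define m where "m = t - 5"
  have m: "7 \<le> m" "t = m + 5"
    using t by (simp_all add: m_def)
  \<comment> \<open>\<open>2944 = 92 * 32\<close> and \<open>m = (t - 10) + 5\<close>.\<close>
  define n :: nat where "n = 92 * 2 ^ m - 3"
  have "t - 10 = m - 5" "m = (m - 5) + 5"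
    using m by auto
  then have "(2 :: nat) ^ m = 2 ^ (t - 10) * 2 ^ 5"
    by (metis power_add)
  then have n: "2944 * 2 ^ (t - 10) - 3 = n"
    by (simp add: n_def)
  \<comment> \<open>128 exceeds the 90 columns, so there are enough labels, including a spare
    one.\<close>
  have "(2 :: nat) ^ 7 \<le> 2 ^ m"
    using m(1) by (intro power_increasing) auto
  then have pow: "128 \<le> (2 :: nat) ^ m"
    by simp

  define E :: "bit alg_closure set" where "E = fixed_field 3"
  define F :: "bit alg_closure set" where "F = fixed_field m"
  have card_E: "card E = 8" and card_F: "card F = 2 ^ m"
    using card_fixed_field(2)[of 3, where 'k = "bit alg_closure"]
      card_fixed_field(2)[of m, where 'k = "bit alg_closure"] m(1)
    by (simp_all add: E_def F_def)
  interpret E: finite_char2_subfield E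
    unfolding E_def by (rule finite_char2_subfield_fixed_field) simp
  interpret F: finite_char2_subfield F
    unfolding F_def using m(1) by (intro finite_char2_subfield_fixed_field) simp
  obtain q where q: "q \<in> E" "q \<notin> {0, 1}"
    using E.obtain_not_in[of "{0, 1}"] card_E by auto
  have "card {0, 1, q, 1 + q} < card E"
    using card_E card_length[of "[0, 1, q, 1 + q]"] by simp
  then obtain d where d: "d \<in> E" "d \<notin> {0, 1, q, 1 + q}"
    using E.obtain_not_in[of "{0, 1, q, 1 + q}"] by blast
  interpret B: base_code E q d
    by unfold_locales (use card_E q d in auto)
  let ?V = "B.V \<times> supported {..<4::nat} F"
  obtain D a b where D: "D \<subseteq> ?V" "0 \<notin> D" "card D < (card B.columns + 1) * card F"
    "?V \<subseteq> sums_le D 4" and ab: "a \<in> D" "b \<in> D" "a \<noteq> b" "a + b \<in> D"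
  proof (rule F.concatenation[of B.columns B.V])
    show "card B.columns < card F" "2 < card F"
      using B.card_columns pow by (simp_all add: card_F)
  qed (use B.columns_subset B.finite_columns B.zero_notin_columns B.V_subgroup
      B.three_or_four_columns in blast)+
  have V_subgroup: "is_subgroup ?V"
    by (intro is_subgroup_Times B.V_subgroup is_subgroup_supported F.subgroup)
  have V_finite: "finite ?V"
    by (intro finite_cartesian_product[OF B.V_card(1)] finite_supported finite_lessThan F.finite)
  have "card ?V = 2 ^ 20 * (2 ^ m) ^ 4"
    unfolding card_cartesian_product[of B.V] B.V_card(2) by (simp add: card_supported card_F)
  also have "\<dots> = 2 ^ (4 * t)"
    by (simp add: m(2) power_add mult.commute flip: power_mult)
  finally have V_card: "card ?V = 2 ^ (4 * t)" .
  \<comment> \<open>\<open>92 < 128\<close> bounds \<open>n + 1\<close> by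
    \<open>2 ^ (m + 7)\<close>, and \<open>3 * (m + 7) \<le> 4 * (m + 5)\<close>.\<close>
  have small: "(n + 1) ^ 3 < 2 ^ (4 * t)"
  proof -
    have "n + 1 < 2 ^ (m + 7)"
      using pow by (simp add: n_def power_add)
    then have "(n + 1) ^ 3 < (2 ^ (m + 7)) ^ 3"
      by (intro power_strict_mono) auto
    also have "\<dots> = 2 ^ ((m + 7) * 3)"
      by (simp only: power_mult)
    also have "\<dots> \<le> 2 ^ (4 * t)"
      using m by (intro power_increasing) auto
    finally show ?thesis .
  qed
  \<comment> \<open>The covering set has fewer than \<open>91 * 2 ^ m\<close> elements; arbitrary
    nonzero vectors fill it up to \<open>n\<close>.\<close>
  have "(card B.columns + 1) * card F \<le> 91 * card F"
    using B.card_columns by (intro mult_right_mono) auto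
  with D(3) have "card D < 91 * card F"
    by (rule less_le_trans)
  then have "card D \<le> n"
    using pow by (simp add: card_F n_def)
  moreover have "n \<le> card (?V - {0})"
  proof -
    have "n + 1 \<le> (n + 1) ^ 3"
      by (rule self_le_power) auto
    then show ?thesis
      using small V_card card_Diff1_le[of ?V 0] by (auto simp: card_Diff_singleton_if)
  qed
  ultimately obtain C where C: "D \<subseteq> C" "C \<subseteq> ?V - {0}" "card C = n"
    using exists_subset_between[of D n "?V - {0}"] D(1,2) V_finite by blast
  have "\<exists>H. is_code_RL n (4 * t) 3 4 2 H"
  proof (rule code_from_group[OF V_subgroup V_finite V_card _ _ C(3) _ _ _ ab(3) _ small])
    show "?V \<subseteq> sums_le C 4"
      using D(4) sums_le_mono[OF C(1) order_refl] by (rule order_trans)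
  qed (use C ab in blast)+
  then show ?thesis
    unfolding n .
qed

theorem theorem9p4:
  shows "(\<forall>t::nat. 12 \<le> t \<longrightarrow>
            (\<exists>H. is_code_RL (2944 * 2 ^ (t - 10) - 3) (4 * t) 3 4 2 H))
       \<and> (\<forall>t::nat. 12 \<le> t \<longrightarrow> ell2 (4 * t) 4 \<le> 2944 * 2 ^ (t - 10) - 3)"
proof (intro conjI allI impI)
  fix t :: nat assume t: "12 \<le> t"
  show "\<exists>H. is_code_RL (2944 * 2 ^ (t - 10) - 3) (4 * t) 3 4 2 H"
    using code_exists[OF t] .
  then show "ell2 (4 * t) 4 \<le> 2944 * 2 ^ (t - 10) - 3"
    unfolding ell2_def is_code_RL_def by (intro Least_le) blast
qed

end
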